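(* Let $M\ge 1$, let $\mu_1,\dots,\mu_M\in\mathbb{R}$, $\sigma_1,\dots,\sigma_M>0$, $P_i=\mathcal N(\mu_i,\sigma_i^2)$, $P_{\mathrm{ens}}=\frac1M\sum_{i=1}^M P_i$, $P_*=\mathcal N(\mu_*,\sigma_*^2)$ and $\bar P_*=\mathcal N(\mu_*,\bar\sigma_*^2)$, where $\mu_*=\frac1M\sum_{i=1}^M\mu_i$, $\sigma_*^2=\frac1M\sum_{i=1}^M(\sigma_i^2+\mu_i^2)-\mu_*^2$ and $\bar\sigma_*^2=\frac1M\sum_{i=1}^M\sigma_i^2$. Let $H$ and $d$ be the entropy and divergence functions of the logarithmic score. Then the following hold. Bayes risks: $$\frac1M\sum_{i=1}^M H(P_i)=\frac1{2M}\sum_{i=1}^M\log(2\pi e\,\sigma_i^2),\qquad H(P_{\mathrm{ens}})\ge\frac1M\sum_{i=1}^M H(P_i),\qquad H(P_* )=\tfrac12\log(2\pi e\,\sigma_*^2).$$ Excess risks: $$\frac1{M^2}\sum_{i=1}^M\sum_{j=1}^M d(P_i,P_j)=\frac1{2M^2}\sum_{i=1}^M\sum_{j=1}^M\Big[\frac{\sigma_j^2+(\mu_i-\mu_j)^2}{\sigma_i^2}-1\Big],$$ $$\frac1M\sum_{i=1}^M d(P_{\mathrm{ens}},P_i)=\frac1M\sum_{i=1}^M D_{\mathrm{KL}}(P_i\,\|\,P_{\mathrm{ens}}),\qquad \frac1M\sum_{i=1}^M d(P_i,P_{\mathrm{ens}})=\frac1M\sum_{i=1}^M D_{\mathrm{KL}}(P_{\mathrm{ens}}\,\|\,P_i),$$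 $$\frac1M\sum_{i=1}^M d(P_*,P_i)=\frac12\Big[\log(\sigma_*^2)-\frac1M\sum_{i=1}^M\log(\sigma_i^2)\Big],$$ $$\frac1M\sum_{i=1}^M d(\bar P_*,P_i)=\frac12\Big[\log(\bar\sigma_*^2)-\frac1M\sum_{i=1}^M\log(\sigma_i^2)+\frac1{\bar\sigma_*^2M}\sum_{i=1}^M(\mu_i-\mu_* )^2\Big],$$ $$d(P_*,P_{\mathrm{ens}})=D_{\mathrm{KL}}(P_{\mathrm{ens}}\,\|\,P_* ).$$
   Context: For a probability measure $P$ on $\mathbb{R}$ with Lebesgue density $p$ and $y\in\mathbb{R}$, the logarithmic score is $\mathrm{LS}(P,y)=-\log p(y)$. For probability measures $P,Q$ the expected score is $S(P,Q)=\int \mathrm{LS}(P,y)\,dQ(y)$. The entropy function is $H(P)=S(P,P)$ and the divergence function is $d(P,Q)=S(P,Q)-H(Q)$ (first argument: prediction; second argument: true distribution). $D_{\mathrm{KL}}(Q\,\|\,P)=\int q\log(q/p)$ is the Kullback–Leibler divergence between measures with densities $q$ and $p$. $\mathcal N(\mu,\sigma^2)$ is the Gaussian with mean $\mu$ and variance $\sigma^2$; $P_{\mathrm{ens}}$ is the equally weighted Gaussian mixture, whose mean and variance are $\mu_*$ and $\sigma_*^2$. *)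

theory Defs
  imports "HOL-Probability.Probability"
begin

(* The second argument is the variance, whereas normal_density takes the standard deviation. *)
definition gaussian :: "real \<Rightarrow> real \<Rightarrow> real measure" where
  "gaussian m v = density lborel (normal_density m (sqrt v))"

definition uniform_mixture :: "nat \<Rightarrow> (nat \<Rightarrow> real measure) \<Rightarrow> real measure" where
  "uniform_mixture M P =
     measure_of UNIV (sets borel) (\<lambda>A. (\<Sum>i=1..M. emeasure (P i) A) / of_nat M)"

lemma sets_uniform_mixture [simp, measurable_cong]: "sets (uniform_mixture M P) = sets borel"
  using sets.sigma_sets_eq[of "borel :: real measure"] by (simp add: uniform_mixture_def)

lemma space_uniform_mixture [simp]: "space (uniform_mixture M P) = UNIV"
  by (simp add: uniform_mixture_def)

(* The set function above is countably additive, so measure_of does not collapse to the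
   null measure. *)
lemma emeasure_uniform_mixture:
  assumes P: "\<And>i. i \<in> {1..M} \<Longrightarrow> sets (P i) = sets borel" and A: "A \<in> sets borel"
  shows "emeasure (uniform_mixture M P) A = (\<Sum>i=1..M. emeasure (P i) A) / of_nat M"
proof (rule emeasure_measure_of[OF uniform_mixture_def])
  show "countably_additive (sets (uniform_mixture M P))
          (\<lambda>A. (\<Sum>i=1..M. emeasure (P i) A) / of_nat M)"
  proof (rule countably_additiveI)
    fix B :: "nat \<Rightarrow> real set"
    assume B: "range B \<subseteq> sets (uniform_mixture M P)" "disjoint_family B"
    have "(\<Sum>n. (\<Sum>i=1..M. emeasure (P i) (B n)) / of_nat M)
            = (\<Sum>n. \<Sum>i=1..M. emeasure (P i) (B n)) / of_nat M"
      by simp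
    also have "(\<Sum>n. \<Sum>i=1..M. emeasure (P i) (B n)) = (\<Sum>i=1..M. \<Sum>n. emeasure (P i) (B n))"
      by (rule suminf_sum) simp
    also have "\<dots> = (\<Sum>i=1..M. emeasure (P i) (\<Union>n. B n))"
      using B P by (intro sum.cong refl suminf_emeasure) auto
    finally show "(\<Sum>n. (\<Sum>i=1..M. emeasure (P i) (B n)) / of_nat M)
                    = (\<Sum>i=1..M. emeasure (P i) (\<Union>n. B n)) / of_nat M" .
  qed
qed (use A in \<open>auto simp: positive_def\<close>)

definition log_score :: "real measure \<Rightarrow> real \<Rightarrow> real" where
  "log_score P y = - ln (enn2real (RN_deriv lborel P y))"

definition expected_score :: "real measure \<Rightarrow> real measure \<Rightarrow> real" where
  "expected_score P Q = (\<integral>y. log_score P y \<partial>Q)"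

definition score_entropy :: "real measure \<Rightarrow> real" where
  "score_entropy P = expected_score P P"

definition score_divergence :: "real measure \<Rightarrow> real measure \<Rightarrow> real" where
  "score_divergence P Q = expected_score P Q - score_entropy Q"

(* KL_divergence b M N integrates log b (dN/dM) against N, so its arguments are in the opposite
   order to the usual notation D_KL(N || M). *)
definition D_KL :: "real measure \<Rightarrow> real measure \<Rightarrow> real" where
  "D_KL Q P = KL_divergence (exp 1) P Q"

lemma D_KL_density:
  fixes p q :: "real \<Rightarrow> real"
  assumes "p \<in> borel_measurable lborel" "AE x in lborel. 0 \<le> p x"
    and "q \<in> borel_measurable lborel" "AE x in lborel. 0 \<le> q x"
    and "AE x in lborel. p x = 0 \<longrightarrow> q x = 0"
  shows "D_KL (density lborel q) (density lborel p) = (\<integral>x. q x * ln (q x / p x) \<partial>lborel)"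
  unfolding D_KL_def using lborel.KL_density_density[OF _ assms, of "exp 1"]
  by (simp add: log_def)

end

theory Submission
  imports Defs
begin

(* All the densities involved lie between exp (- C (1 + x^2)) and exp (C (1 + x^2)) and have a
   finite second moment. Hence their log scores grow at most quadratically and all integrals exist,
   so that d(P, Q) = D_KL(Q || P) >= 0. The score of a Gaussian is a quadratic polynomial, which
   gives the closed forms; averaging H(P_i) <= S(P_ens, P_i) over i gives the entropy bound, since
   the score is linear in the true distribution. *)

section \<open>Densities with at most quadratic logarithm\<close>

text \<open>The two-sided bound passes to averages, so the class contains Gaussian mixtures although
  their logarithm has no closed form. The lower bound makes \<open>f\<close> positive everywhere,
  which keeps the logarithms and quotients below away from their default values at 0.\<close>

definition tame_density :: "(real \<Rightarrow> real) \<Rightarrow> bool" where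
  "tame_density f \<longleftrightarrow>
     f \<in> borel_measurable borel \<and> has_bochner_integral lborel f 1 \<and>
     integrable lborel (\<lambda>x. f x * x\<^sup>2) \<and>
     (\<exists>C. \<forall>x. exp (- (C * (1 + x\<^sup>2))) \<le> f x \<and> f x \<le> exp (C * (1 + x\<^sup>2)))"

lemma tame_density_pos: "tame_density f \<Longrightarrow> 0 < f x"
  unfolding tame_density_def by (meson exp_gt_zero less_le_trans)

lemma tame_density_measurable: "tame_density f \<Longrightarrow> f \<in> borel_measurable borel"
  by (simp add: tame_density_def)

lemma tame_density_has_integral: "tame_density f \<Longrightarrow> has_bochner_integral lborel f 1"
  by (simp add: tame_density_def)

lemma tame_density_abs_ln:
  assumes "tame_density f"
  obtains C where "\<And>x. \<bar>ln (f x)\<bar> \<le> C * (1 + x\<^sup>2)"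
proof -
  obtain C where C: "\<And>x. exp (- (C * (1 + x\<^sup>2))) \<le> f x" "\<And>x. f x \<le> exp (C * (1 + x\<^sup>2))"
    using assms by (auto simp: tame_density_def)
  have "\<bar>ln (f x)\<bar> \<le> C * (1 + x\<^sup>2)" for x
    using C[of x] tame_density_pos[OF assms, of x]
    by (metis abs_le_iff exp_gt_zero ln_exp ln_le_cancel_iff minus_le_iff)
  then show thesis by (rule that)
qed

text \<open>Domination by \<open>C * (g x + g x * x\<^sup>2)\<close>: the constant comes from the
  logarithm of \<open>f\<close>, the finite mass and second moment from \<open>g\<close>. Any two
  tame densities can therefore be paired as prediction and truth.\<close>

lemma tame_density_integrable_mult_ln:
  assumes f: "tame_density f" and g: "tame_density g"
  shows "integrable lborel (\<lambda>x. g x * ln (f x))"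
proof -
  obtain C where C: "\<And>x. \<bar>ln (f x)\<bar> \<le> C * (1 + x\<^sup>2)"
    using tame_density_abs_ln[OF f] by blast
  note [measurable] = tame_density_measurable[OF f] tame_density_measurable[OF g]
  have "integrable lborel g" "integrable lborel (\<lambda>x. g x * x\<^sup>2)"
    using g by (auto simp: tame_density_def has_bochner_integral_iff)
  then have "integrable lborel (\<lambda>x. C * (g x + g x * x\<^sup>2))"
    by (intro integrable_mult_right Bochner_Integration.integrable_add)
  then show ?thesis
  proof (rule Bochner_Integration.integrable_bound)
    show "AE x in lborel. norm (g x * ln (f x)) \<le> norm (C * (g x + g x * x\<^sup>2))"
    proof (rule AE_I2)
      fix x
      have "norm (g x * ln (f x)) = g x * \<bar>ln (f x)\<bar>"
        using tame_density_pos[OF g, of x] by (simp add: abs_mult)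
      also have "\<dots> \<le> g x * (C * (1 + x\<^sup>2))"
        using C[of x] tame_density_pos[OF g, of x] by (intro mult_left_mono) auto
      also have "\<dots> \<le> norm (C * (g x + g x * x\<^sup>2))"
        by (simp add: algebra_simps)
      finally show "norm (g x * ln (f x)) \<le> norm (C * (g x + g x * x\<^sup>2))" .
    qed
  qed measurable
qed

section \<open>Scores and divergences of tame densities\<close>

text \<open>The formula holds only almost everywhere because \<open>log_score\<close> goes through
  \<open>RN_deriv\<close>, which is determined up to a null set. Its uniqueness rests on Lebesgue
  measure being sigma-finite.\<close>

lemma AE_log_score_density:
  assumes "f \<in> borel_measurable borel" "\<And>x. 0 \<le> f x"
  shows "AE x in lborel. log_score (density lborel f) x = - ln (f x)"
proof -
  have "AE x in lborel. ennreal (f x) = RN_deriv lborel (density lborel f) x"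
    using assms(1)
    by (intro sigma_finite_measure.RN_deriv_unique[OF lborel.sigma_finite_measure_axioms]) auto
  then show ?thesis
  proof eventually_elim
    case (elim x)
    then show ?case
      using assms(2)[of x] by (simp add: log_score_def flip: elim)
  qed
qed

lemma log_score_measurable [measurable]: "log_score P \<in> borel_measurable borel"
  using borel_measurable_RN_deriv[of lborel P] unfolding log_score_def by measurable

text \<open>An integral against \<open>density lborel g\<close> is a Lebesgue integral with weight
  \<open>g\<close>, where the almost everywhere formula for the score may be substituted.\<close>

lemma
  assumes f: "tame_density f" and g: "tame_density g"
  shows integrable_log_score: "integrable (density lborel g) (log_score (density lborel f))"
    and expected_score_density:
      "expected_score (density lborel f) (density lborel g) = - (\<integral>x. g x * ln (f x) \<partial>lborel)"
proof -
  note [measurable] = tame_density_measurable[OF f] tame_density_measurable[OF g]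
  note pos = tame_density_pos[OF f] tame_density_pos[OF g]
  have eq: "AE x in lborel. g x * log_score (density lborel f) x = - (g x * ln (f x))"
    using AE_log_score_density[OF tame_density_measurable[OF f]] pos(1)
    by (auto simp: less_imp_le)
  have "integrable lborel (\<lambda>x. g x * log_score (density lborel f) x)
          \<longleftrightarrow> integrable lborel (\<lambda>x. - (g x * ln (f x)))"
    by (rule integrable_cong_AE) (use eq in auto)
  then show "integrable (density lborel g) (log_score (density lborel f))"
    using tame_density_integrable_mult_ln[OF f g] pos(2)
    by (subst integrable_density) (auto simp: less_imp_le)
  have "expected_score (density lborel f) (density lborel g)
          = (\<integral>x. g x * log_score (density lborel f) x \<partial>lborel)"
    unfolding expected_score_def using pos(2)
    by (subst integral_density) (auto simp: less_imp_le)
  also have "\<dots> = (\<integral>x. - (g x * ln (f x)) \<partial>lborel)"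
    by (rule integral_cong_AE) (use eq in auto)
  finally show "expected_score (density lborel f) (density lborel g)
                  = - (\<integral>x. g x * ln (f x) \<partial>lborel)"
    by simp
qed

text \<open>This makes the Kullback-Leibler divergence a genuine integral rather than the default 0.
  The derivative of the second measure with respect to the first is \<open>g x / f x\<close>, so the
  entropy density is a difference of two logarithms, each integrable against
  \<open>g\<close>.\<close>

lemma integrable_entropy_density:
  assumes f: "tame_density f" and g: "tame_density g"
  shows "integrable (density lborel g)
           (entropy_density (exp 1) (density lborel f) (density lborel g))"
proof -
  note [measurable] = tame_density_measurable[OF f] tame_density_measurable[OF g]
  note pos = tame_density_pos[OF f] tame_density_pos[OF g]
  let ?F = "density lborel f" and ?G = "density lborel g"
  \<comment> \<open>Finiteness of the reference measure supplies the sigma-finiteness under which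
    the Radon-Nikodym derivative is unique.\<close>
  interpret F: finite_measure ?F
  proof
    have "emeasure ?F (space ?F) = (\<integral>\<^sup>+x. f x \<partial>lborel)"
      by (simp add: emeasure_density)
    also have "\<dots> = 1"
      using tame_density_has_integral[OF f] pos(1)
      by (subst nn_integral_eq_integral) (auto simp: has_bochner_integral_iff less_imp_le)
    finally show "emeasure ?F (space ?F) \<noteq> \<infinity>" by simp
  qed
  have "density ?F (\<lambda>x. ennreal (g x / f x)) = ?G"
    using pos
    by (subst density_density_eq)
       (auto intro!: density_cong simp: less_imp_le less_imp_neq[symmetric] simp flip: ennreal_mult)
  then have "AE x in ?F. ennreal (g x / f x) = RN_deriv ?F ?G x"
    by (intro F.RN_deriv_unique) auto
  \<comment> \<open>As \<open>f\<close> is positive everywhere, null sets of \<open>?F\<close> are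
    Lebesgue null sets.\<close>
  then have "AE x in lborel. ennreal (g x / f x) = RN_deriv ?F ?G x"
    using pos by (subst (asm) AE_density) auto
  then have eq: "AE x in lborel. g x * entropy_density (exp 1) ?F ?G x
                   = g x * ln (g x) - g x * ln (f x)"
  proof eventually_elim
    case (elim x)
    have "entropy_density (exp 1) ?F ?G x = ln (g x / f x)"
      using pos[of x] by (simp add: entropy_density_def log_def less_imp_le flip: elim)
    also have "\<dots> = ln (g x) - ln (f x)"
      using pos[of x] by (simp add: ln_div)
    finally show ?case by (simp add: right_diff_distrib)
  qed
  have [measurable]: "entropy_density (exp 1) ?F ?G \<in> borel_measurable borel"
    using measurable_entropy_density[of "exp 1" ?F ?G] by simp
  have "integrable lborel (\<lambda>x. g x * entropy_density (exp 1) ?F ?G x)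
          \<longleftrightarrow> integrable lborel (\<lambda>x. g x * ln (g x) - g x * ln (f x))"
    by (rule integrable_cong_AE) (use eq in auto)
  then show ?thesis
    using tame_density_integrable_mult_ln[OF f g] tame_density_integrable_mult_ln[OF g g] pos(2)
    by (subst integrable_density) (auto simp: less_imp_le)
qed

text \<open>Integrability of \<open>g x * ln (g x)\<close> and of \<open>g x * ln (f x)\<close>
  permits splitting \<open>ln (g x / f x)\<close> under the integral. The two parts are the negated
  entropy of the truth and the negated expected score.\<close>

lemma score_divergence_eq_D_KL:
  assumes f: "tame_density f" and g: "tame_density g"
  shows "score_divergence (density lborel f) (density lborel g)
           = D_KL (density lborel g) (density lborel f)"
proof -
  note pos = tame_density_pos[OF f] tame_density_pos[OF g]
  have "D_KL (density lborel g) (density lborel f) = (\<integral>x. g x * ln (g x / f x) \<partial>lborel)"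
    using pos tame_density_measurable[OF f] tame_density_measurable[OF g]
    by (intro D_KL_density) (auto simp: less_imp_le less_imp_neq[symmetric])
  also have "\<dots> = (\<integral>x. g x * ln (g x) - g x * ln (f x) \<partial>lborel)"
    using pos by (simp add: ln_divide_pos right_diff_distrib)
  also have "\<dots> = (\<integral>x. g x * ln (g x) \<partial>lborel) - (\<integral>x. g x * ln (f x) \<partial>lborel)"
    by (intro Bochner_Integration.integral_diff tame_density_integrable_mult_ln f g)
  finally show ?thesis
    by (simp add: score_divergence_def score_entropy_def expected_score_density f g)
qed

text \<open>Gibbs' inequality, from \<open>ln t \<le> t - 1\<close> at \<open>t = f x / g x\<close>.
  Multiplication by \<open>g x\<close> turns the right-hand side into \<open>f x - g x\<close>,
  whose integral vanishes because both densities have mass 1.\<close>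

lemma score_entropy_le_expected_score:
  assumes f: "tame_density f" and g: "tame_density g"
  shows "score_entropy (density lborel g) \<le> expected_score (density lborel f) (density lborel g)"
proof -
  note pos = tame_density_pos[OF f] tame_density_pos[OF g]
  have int: "integrable lborel f" "integrable lborel g" "integral\<^sup>L lborel f = 1"
    "integral\<^sup>L lborel g = 1"
    using tame_density_has_integral[OF f] tame_density_has_integral[OF g]
    by (auto simp: has_bochner_integral_iff)
  have "(\<integral>x. g x * ln (f x) - g x * ln (g x) \<partial>lborel) \<le> (\<integral>x. f x - g x \<partial>lborel)"
  proof (rule integral_mono)
    fix x
    have "g x * (ln (f x) - ln (g x)) \<le> g x * (f x / g x - 1)"
      using pos[of x] ln_le_minus_one[of "f x / g x"]
      by (intro mult_left_mono) (auto simp: ln_div)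
    then show "g x * ln (f x) - g x * ln (g x) \<le> f x - g x"
      using pos(2)[of x] by (simp add: algebra_simps)
  qed (auto intro!: tame_density_integrable_mult_ln f g int Bochner_Integration.integrable_diff)
  then show ?thesis
    by (simp add: score_entropy_def expected_score_density f g int
        tame_density_integrable_mult_ln)
qed

section \<open>Gaussian densities\<close>

text \<open>Expand \<open>x - a\<close> as \<open>(x - m) + (m - a)\<close> and insert the central
  moments of order 0, 1 and 2. The point \<open>a\<close> is free because the score of a Gaussian
  prediction is quadratic around the predicted mean, not the true one.\<close>

lemma normal_density_has_second_moment:
  assumes s: "0 < s"
  shows "has_bochner_integral lborel (\<lambda>x. normal_density m s x * (x - a)\<^sup>2) (s\<^sup>2 + (m - a)\<^sup>2)"
proof -
  have 2: "has_bochner_integral lborel (\<lambda>x. normal_density m s x * (x - m)\<^sup>2) (s\<^sup>2)"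
    using normal_moment_even[OF s, of m 1] by simp
  have 1: "has_bochner_integral lborel (\<lambda>x. normal_density m s x * (x - m)) 0"
    using normal_moment_odd[OF s, of m 0] by simp
  have 0: "has_bochner_integral lborel (normal_density m s) 1"
    using s by (simp add: has_bochner_integral_iff)
  have "has_bochner_integral lborel
     (\<lambda>x. normal_density m s x * (x - m)\<^sup>2 +
        ((2 * (m - a)) * (normal_density m s x * (x - m)) + (m - a)\<^sup>2 * normal_density m s x))
     (s\<^sup>2 + ((2 * (m - a)) * 0 + (m - a)\<^sup>2 * 1))"
    by (intro has_bochner_integral_add has_bochner_integral_mult_right 0 1 2)
  moreover have "normal_density m s x * (x - m)\<^sup>2 +
        ((2 * (m - a)) * (normal_density m s x * (x - m)) + (m - a)\<^sup>2 * normal_density m s x)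
      = normal_density m s x * (x - a)\<^sup>2" for x
    by (simp add: power2_eq_square algebra_simps)
  ultimately show ?thesis by simp
qed

lemma ln_normal_density:
  assumes "0 < s"
  shows "ln (normal_density m s x) = - ((x - m)\<^sup>2 / (2 * s\<^sup>2)) - ln (2 * pi * s\<^sup>2) / 2"
  using assms unfolding normal_density_def
  by (subst ln_mult) (auto simp: ln_div ln_sqrt)

lemma tame_normal_density:
  assumes s: "0 < s"
  shows "tame_density (normal_density m s)"
proof -
  \<comment> \<open>\<open>L\<close> absorbs the normalising constant in the logarithm, whose sign
    depends on \<open>s\<close>. The other summand of \<open>C\<close> bounds the quadratic
    part.\<close>
  define L where "L = \<bar>ln (2 * pi * s\<^sup>2) / 2\<bar>"
  define C where "C = (1 + m\<^sup>2) / s\<^sup>2 + L"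
  have "exp (- (C * (1 + x\<^sup>2))) \<le> normal_density m s x \<and>
        normal_density m s x \<le> exp (C * (1 + x\<^sup>2))" for x
  proof -
    \<comment> \<open>This square equals
      \<open>2 * (x\<^sup>2 + m\<^sup>2) - (x - m)\<^sup>2\<close>.\<close>
    have "0 \<le> (x + m)\<^sup>2" by simp
    then have "(x - m)\<^sup>2 \<le> 2 * (x\<^sup>2 + m\<^sup>2)"
      by (simp add: power2_eq_square algebra_simps)
    also have "\<dots> \<le> 2 * ((1 + m\<^sup>2) * (1 + x\<^sup>2))"
      by (simp add: algebra_simps)
    finally have "(x - m)\<^sup>2 / (2 * s\<^sup>2) \<le> 2 * ((1 + m\<^sup>2) * (1 + x\<^sup>2)) / (2 * s\<^sup>2)"
      by (rule divide_right_mono) simp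
    then have "(x - m)\<^sup>2 / (2 * s\<^sup>2) \<le> (1 + m\<^sup>2) / s\<^sup>2 * (1 + x\<^sup>2)"
      by simp
    moreover have "0 \<le> (x - m)\<^sup>2 / (2 * s\<^sup>2)" by simp
    moreover have "L \<le> L * (1 + x\<^sup>2)"
      by (simp add: L_def mult_le_cancel_left1)
    moreover have "C * (1 + x\<^sup>2) = (1 + m\<^sup>2) / s\<^sup>2 * (1 + x\<^sup>2) + L * (1 + x\<^sup>2)"
      by (simp add: C_def distrib_right)
    ultimately have "- (C * (1 + x\<^sup>2)) \<le> ln (normal_density m s x)"
      "ln (normal_density m s x) \<le> C * (1 + x\<^sup>2)"
      unfolding ln_normal_density[OF s] L_def by linarith+
    then show ?thesis
      using normal_density_pos[OF s, of m x] by (metis exp_le_cancel_iff exp_ln)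
  qed
  then show ?thesis
    using s normal_density_has_second_moment[OF s, of m 0]
    by (auto simp: tame_density_def has_bochner_integral_iff)
qed

section \<open>Uniform mixtures\<close>

text \<open>Bounds shared by all components are inherited by their average, so it suffices to find
  one constant for all of them. Mass and second moment are finite sums of those of the
  components.\<close>

lemma tame_density_average:
  assumes M: "1 \<le> M" and p: "\<And>i. i \<in> {1..M} \<Longrightarrow> tame_density (p i)"
  shows "tame_density (\<lambda>x. (\<Sum>i=1..M. p i x) / real M)"
proof -
  have [measurable]: "\<And>i. i \<in> {1..M} \<Longrightarrow> p i \<in> borel_measurable borel"
    using p by (simp add: tame_density_def)
  obtain c where c: "\<And>i x. i \<in> {1..M} \<Longrightarrow>
      exp (- (c i * (1 + x\<^sup>2))) \<le> p i x \<and> p i x \<le> exp (c i * (1 + x\<^sup>2))"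
    using p unfolding tame_density_def by metis
  \<comment> \<open>At \<open>x = 0\<close> the bounds read
    \<open>exp (- c i) \<le> p i 0 \<le> exp (c i)\<close>. Nonnegativity then makes the sum
    \<open>C\<close> an upper bound for every \<open>c i\<close>.\<close>
  have c0: "0 \<le> c i" if "i \<in> {1..M}" for i
    using order_trans[of "exp (- c i)" "p i 0" "exp (c i)"] c[OF that, of 0] by simp
  define C where "C = (\<Sum>i=1..M. c i)"
  have le: "c i \<le> C" if "i \<in> {1..M}" for i
    unfolding C_def using that c0 by (intro member_le_sum) auto
  have bounds: "exp (- (C * (1 + x\<^sup>2))) \<le> p i x" "p i x \<le> exp (C * (1 + x\<^sup>2))"
    if i: "i \<in> {1..M}" for i x
  proof -
    have "c i * (1 + x\<^sup>2) \<le> C * (1 + x\<^sup>2)"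
      using le[OF i] by (intro mult_right_mono) auto
    then show "exp (- (C * (1 + x\<^sup>2))) \<le> p i x" "p i x \<le> exp (C * (1 + x\<^sup>2))"
      using c[OF i, of x] by (meson exp_le_cancel_iff neg_le_iff_le order_trans)+
  qed
  have "exp (- (C * (1 + x\<^sup>2))) \<le> (\<Sum>i=1..M. p i x) / real M \<and>
        (\<Sum>i=1..M. p i x) / real M \<le> exp (C * (1 + x\<^sup>2))" for x
    using sum_bounded_below[of "{1..M}" "exp (- (C * (1 + x\<^sup>2)))" "\<lambda>i. p i x"]
      sum_bounded_above[of "{1..M}" "\<lambda>i. p i x" "exp (C * (1 + x\<^sup>2))"] bounds M
    by (auto simp: field_simps)
  moreover have "has_bochner_integral lborel (\<lambda>x. (\<Sum>i=1..M. p i x) / real M)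
      ((\<Sum>i=1..M. 1) / real M)"
    using p by (intro has_bochner_integral_divide_zero has_bochner_integral_sum)
      (auto simp: tame_density_has_integral)
  moreover have "integrable lborel (\<lambda>x. (\<Sum>i=1..M. p i x * x\<^sup>2) / real M)"
    using p by (intro integrable_divide_zero Bochner_Integration.integrable_sum)
      (auto simp: tame_density_def)
  ultimately show ?thesis
    using M by (auto simp: tame_density_def sum_distrib_right)
qed

text \<open>The measures agree on Borel sets because finite sums and division by \<open>M\<close>
  commute with the nonnegative integral.\<close>

lemma uniform_mixture_density:
  fixes p :: "nat \<Rightarrow> real \<Rightarrow> real"
  assumes M: "1 \<le> M"
    and p: "\<And>i. i \<in> {1..M} \<Longrightarrow> p i \<in> borel_measurable borel"
      "\<And>i x. i \<in> {1..M} \<Longrightarrow> 0 \<le> p i x"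
    and P: "\<And>i. i \<in> {1..M} \<Longrightarrow> P i = density lborel (p i)"
  shows "uniform_mixture M P = density lborel (\<lambda>x. (\<Sum>i=1..M. p i x) / real M)"
proof (rule measure_eqI)
  fix A assume "A \<in> sets (uniform_mixture M P)"
  then have A [measurable]: "A \<in> sets borel" by simp
  note [measurable] = p(1)
  \<comment> \<open>Nonnegativity lets \<open>ennreal\<close> pass through the sum, and
    \<open>M \<ge> 1\<close> lets it pass through the quotient.\<close>
  have *: "ennreal ((\<Sum>i=1..M. p i x) / real M) = (\<Sum>i=1..M. ennreal (p i x)) / of_nat M" for x
  proof -
    have "0 \<le> (\<Sum>i=1..M. p i x)"
      using p(2) by (intro sum_nonneg)
    moreover have "(\<Sum>i=1..M. ennreal (p i x)) = ennreal (\<Sum>i=1..M. p i x)"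
      using p(2) by (intro sum_ennreal)
    ultimately show ?thesis
      using M by (simp only: ennreal_of_nat_eq_real_of_nat) (simp add: divide_ennreal)
  qed
  have "emeasure (uniform_mixture M P) A = (\<Sum>i=1..M. emeasure (density lborel (p i)) A) / of_nat M"
    using P by (subst emeasure_uniform_mixture) auto
  also have "\<dots> = (\<Sum>i=1..M. \<integral>\<^sup>+x. ennreal (p i x) * indicator A x \<partial>lborel) / of_nat M"
    by (simp add: emeasure_density)
  also have "\<dots> = (\<integral>\<^sup>+x. (\<Sum>i=1..M. ennreal (p i x) * indicator A x) / of_nat M \<partial>lborel)"
    by (subst nn_integral_divide, measurable, subst nn_integral_sum) auto
  also have "\<dots> = (\<integral>\<^sup>+x. ennreal ((\<Sum>i=1..M. p i x) / real M) * indicator A x \<partial>lborel)"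
    unfolding * sum_distrib_right[symmetric] by (simp add: divide_ennreal_def ac_simps)
  also have "\<dots> = emeasure (density lborel (\<lambda>x. (\<Sum>i=1..M. p i x) / real M)) A"
    by (subst emeasure_density) auto
  finally show "emeasure (uniform_mixture M P) A
      = emeasure (density lborel (\<lambda>x. (\<Sum>i=1..M. p i x) / real M)) A" .
qed simp

text \<open>With the prediction fixed, the integrand is linear in the true density. Integrability of
  each \<open>p i x * ln (f x)\<close> justifies exchanging sum and integral.\<close>

lemma expected_score_average:
  assumes "1 \<le> M" and f: "tame_density f" and p: "\<And>i. i \<in> {1..M} \<Longrightarrow> tame_density (p i)"
  shows "expected_score (density lborel f) (density lborel (\<lambda>x. (\<Sum>i=1..M. p i x) / real M))
           = (\<Sum>i=1..M. expected_score (density lborel f) (density lborel (p i))) / real M"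
proof -
  have "(\<integral>x. (\<Sum>i=1..M. p i x) / real M * ln (f x) \<partial>lborel)
          = (\<integral>x. (\<Sum>i=1..M. p i x * ln (f x)) / real M \<partial>lborel)"
    by (simp add: sum_distrib_right)
  also have "\<dots> = (\<Sum>i=1..M. \<integral>x. p i x * ln (f x) \<partial>lborel) / real M"
    using p f by (simp add: tame_density_integrable_mult_ln Bochner_Integration.integral_sum)
  finally show ?thesis
    using f p tame_density_average[OF assms(1) p] by (simp add: expected_score_density sum_negf)
qed

section \<open>Closed forms for Gaussian scores\<close>

text \<open>The score is a quadratic polynomial in \<open>x - a\<close>, so only the mass of the
  true Gaussian and its second moment about \<open>a\<close> enter.\<close>

lemma expected_score_normal:
  assumes s: "0 < s" and t: "0 < t"
  shows "expected_score (density lborel (normal_density a s)) (density lborel (normal_density m t))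
           = (t\<^sup>2 + (m - a)\<^sup>2) / (2 * s\<^sup>2) + ln (2 * pi * s\<^sup>2) / 2"
proof -
  note * = normal_density_has_second_moment[OF t, of m a]
  have "(\<integral>x. normal_density m t x * ln (normal_density a s x) \<partial>lborel)
     = (\<integral>x. (- 1 / (2 * s\<^sup>2)) * (normal_density m t x * (x - a)\<^sup>2)
           - (ln (2 * pi * s\<^sup>2) / 2) * normal_density m t x \<partial>lborel)"
    by (simp add: ln_normal_density[OF s] algebra_simps)
  also have "\<dots> = (- 1 / (2 * s\<^sup>2)) * (t\<^sup>2 + (m - a)\<^sup>2) - (ln (2 * pi * s\<^sup>2) / 2) * 1"
    using * t
    by (intro has_bochner_integral_integral_eq has_bochner_integral_diff
        has_bochner_integral_mult_right) (auto simp: has_bochner_integral_iff)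
  finally show ?thesis
    using s t by (simp add: expected_score_density tame_normal_density)
qed

text \<open>For equal parameters the quadratic term is 1/2, which is half of
  \<open>ln (exp 1)\<close> and merges into the logarithm.\<close>

lemma score_entropy_normal:
  assumes "0 < s"
  shows "score_entropy (density lborel (normal_density m s)) = ln (2 * pi * exp 1 * s\<^sup>2) / 2"
proof -
  have "ln (2 * pi * exp 1 * s\<^sup>2) = ln (exp 1 * (2 * pi * s\<^sup>2))"
    by (simp add: ac_simps)
  also have "\<dots> = 1 + ln (2 * pi * s\<^sup>2)"
    using assms by (subst ln_mult) auto
  finally show ?thesis
    using assms by (simp add: score_entropy_def expected_score_normal add_divide_distrib)
qed

lemma score_divergence_normal:
  assumes s: "0 < s" and t: "0 < t"
  shows "score_divergence (density lborel (normal_density a s)) (density lborel (normal_density m t))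
           = ((t\<^sup>2 + (m - a)\<^sup>2) / s\<^sup>2 - 1 + ln (s\<^sup>2) - ln (t\<^sup>2)) / 2"
proof -
  \<comment> \<open>The summand \<open>ln (2 * pi)\<close> cancels between expected score and
    entropy.\<close>
  have "ln (2 * pi * s\<^sup>2) = ln (2 * pi) + ln (s\<^sup>2)" "ln (2 * pi * t\<^sup>2) = ln (2 * pi) + ln (t\<^sup>2)"
    using s t by (simp_all add: ln_mult)
  then show ?thesis
    using s t unfolding score_divergence_def score_entropy_def
    by (simp add: expected_score_normal field_simps)
qed

section \<open>Bayes risks and excess risks\<close>

theorem mainTheorem2:
  fixes M :: nat and \<mu> \<sigma> :: "nat \<Rightarrow> real"
    and mu_star var_star var_bar :: real
    and P :: "nat \<Rightarrow> real measure" and P_ens P_star P_bar :: "real measure"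
  assumes "M \<ge> 1"
    and "\<And>i. i \<in> {1..M} \<Longrightarrow> \<sigma> i > 0"
    and "mu_star = (1 / real M) * (\<Sum>i=1..M. \<mu> i)"
    and "var_star = (1 / real M) * (\<Sum>i=1..M. (\<sigma> i)\<^sup>2 + (\<mu> i)\<^sup>2) - mu_star\<^sup>2"
    and "var_bar = (1 / real M) * (\<Sum>i=1..M. (\<sigma> i)\<^sup>2)"
    and "\<And>i. P i = gaussian (\<mu> i) ((\<sigma> i)\<^sup>2)"
    and "P_ens = uniform_mixture M P"
    and "P_star = gaussian mu_star var_star"
    and "P_bar = gaussian mu_star var_bar"
  shows
    \<comment> \<open>All the integrals below exist (the Bochner integral of a non-integrable function is 0).\<close>
    "((\<forall>i\<in>{1..M}. \<forall>j\<in>{1..M}. integrable (P j) (log_score (P i))) \<and>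
      integrable P_ens (log_score P_ens) \<and>
      integrable P_star (log_score P_star) \<and>
      integrable P_ens (log_score P_star) \<and>
      integrable P_ens (entropy_density (exp 1) P_star P_ens) \<and>
      (\<forall>i\<in>{1..M}.
        integrable (P i) (log_score P_ens) \<and>
        integrable P_ens (log_score (P i)) \<and>
        integrable (P i) (log_score P_star) \<and>
        integrable (P i) (log_score P_bar) \<and>
        integrable (P i) (entropy_density (exp 1) P_ens (P i)) \<and>
        integrable P_ens (entropy_density (exp 1) (P i) P_ens))) \<and>

     (1 / real M) * (\<Sum>i=1..M. score_entropy (P i))
        = (1 / (2 * real M)) * (\<Sum>i=1..M. ln (2 * pi * exp 1 * (\<sigma> i)\<^sup>2)) \<and>
     score_entropy P_ens \<ge> (1 / real M) * (\<Sum>i=1..M. score_entropy (P i)) \<and>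
     score_entropy P_star = (1 / 2) * ln (2 * pi * exp 1 * var_star) \<and>

     (1 / (real M)\<^sup>2) * (\<Sum>i=1..M. \<Sum>j=1..M. score_divergence (P i) (P j))
        = (1 / (2 * (real M)\<^sup>2)) *
          (\<Sum>i=1..M. \<Sum>j=1..M. ((\<sigma> j)\<^sup>2 + (\<mu> i - \<mu> j)\<^sup>2) / (\<sigma> i)\<^sup>2 - 1) \<and>
     (1 / real M) * (\<Sum>i=1..M. score_divergence P_ens (P i))
        = (1 / real M) * (\<Sum>i=1..M. D_KL (P i) P_ens) \<and>
     (1 / real M) * (\<Sum>i=1..M. score_divergence (P i) P_ens)
        = (1 / real M) * (\<Sum>i=1..M. D_KL P_ens (P i)) \<and>
     (1 / real M) * (\<Sum>i=1..M. score_divergence P_star (P i))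
        = (1 / 2) * (ln var_star - (1 / real M) * (\<Sum>i=1..M. ln ((\<sigma> i)\<^sup>2))) \<and>
     (1 / real M) * (\<Sum>i=1..M. score_divergence P_bar (P i))
        = (1 / 2) * (ln var_bar - (1 / real M) * (\<Sum>i=1..M. ln ((\<sigma> i)\<^sup>2))
            + (1 / (var_bar * real M)) * (\<Sum>i=1..M. (\<mu> i - mu_star)\<^sup>2)) \<and>
     score_divergence P_star P_ens = D_KL P_ens P_star"
proof -
  note M = assms(1) and \<sigma> = assms(2) and mu_star = assms(3) and var_star = assms(4)
    and var_bar = assms(5)
  \<comment> \<open>The Lebesgue densities of \<open>P i\<close>, \<open>P_ens\<close>,
    \<open>P_star\<close> and \<open>P_bar\<close>, in this order.\<close>
  define p where "p i = normal_density (\<mu> i) (\<sigma> i)" for i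
  define r where "r x = (\<Sum>i=1..M. p i x) / real M" for x
  define q where "q = normal_density mu_star (sqrt var_star)"
  define b where "b = normal_density mu_star (sqrt var_bar)"
  let ?D = "\<lambda>f. density lborel (\<lambda>x. ennreal (f x))"
  have M0: "real M > 0" using M by simp
  \<comment> \<open>Preparation for the law of total variance: \<open>var_star\<close> is the mean
    of the variances plus the mean squared deviation of the means.\<close>
  have deviations: "(\<Sum>i=1..M. (\<mu> i - mu_star)\<^sup>2) = (\<Sum>i=1..M. (\<mu> i)\<^sup>2) - real M * mu_star\<^sup>2"
  proof -
    have "(\<Sum>i=1..M. (\<mu> i - mu_star)\<^sup>2)
        = (\<Sum>i=1..M. (\<mu> i)\<^sup>2) - 2 * mu_star * (\<Sum>i=1..M. \<mu> i) + real M * mu_star\<^sup>2"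
      by (simp add: power2_diff sum.distrib sum_subtractf sum_distrib_left mult.assoc mult.commute
          mult.left_commute)
    also have "(\<Sum>i=1..M. \<mu> i) = real M * mu_star"
      using M0 by (simp add: mu_star)
    finally show ?thesis by (simp add: power2_eq_square)
  qed
  \<comment> \<open>This form shows that \<open>var_star\<close> is positive, and its right-hand
    side is the sum that occurs in the averaged divergence.\<close>
  have var_star_eq: "real M * var_star = (\<Sum>i=1..M. (\<sigma> i)\<^sup>2 + (\<mu> i - mu_star)\<^sup>2)"
    using M0 unfolding sum.distrib deviations by (simp add: var_star sum.distrib right_diff_distrib)
  have var_bar_eq: "real M * var_bar = (\<Sum>i=1..M. (\<sigma> i)\<^sup>2)"
    using M0 by (simp add: var_bar)
  \<comment> \<open>The index range is nonempty since \<open>M \<ge> 1\<close>. Strict positivity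
    makes \<open>P_star\<close> and \<open>P_bar\<close> nondegenerate.\<close>
  have sum_pos: "0 < (\<Sum>i=1..M. (\<sigma> i)\<^sup>2)"
    using M \<sigma> by (intro sum_pos) (force simp: less_imp_neq[symmetric])+
  have "0 < real M * var_star" "0 < real M * var_bar"
    using sum_pos sum_nonneg[of "{1..M}" "\<lambda>i. (\<mu> i - mu_star)\<^sup>2"]
    unfolding var_star_eq var_bar_eq by (auto simp: sum.distrib)
  then have var_star_pos: "0 < var_star" and var_bar_pos: "0 < var_bar"
    using M0 by (auto simp: zero_less_mult_iff)
  have tame_p: "\<And>i. i \<in> {1..M} \<Longrightarrow> tame_density (p i)"
    using \<sigma> by (simp add: p_def tame_normal_density)
  have tame_r: "tame_density r"
    unfolding r_def by (rule tame_density_average[OF M tame_p])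
  have tame_q: "tame_density q" and tame_b: "tame_density b"
    using var_star_pos var_bar_pos by (simp_all add: q_def b_def tame_normal_density)
  have P: "P i = ?D (p i)" if "i \<in> {1..M}" for i
    using \<sigma>[OF that] by (simp add: assms(6) gaussian_def p_def)
  have P_ens: "P_ens = ?D r"
    unfolding assms(7) r_def
    by (rule uniform_mixture_density[OF M _ _ P])
       (auto simp: tame_density_measurable tame_p tame_density_pos less_imp_le)
  have P_star: "P_star = ?D q" and P_bar: "P_bar = ?D b"
    by (simp_all add: assms(8,9) gaussian_def q_def b_def)
  have divergence_P: "score_divergence (P i) (P j)
      = (((\<sigma> j)\<^sup>2 + (\<mu> i - \<mu> j)\<^sup>2) / (\<sigma> i)\<^sup>2 - 1 + ln ((\<sigma> i)\<^sup>2) - ln ((\<sigma> j)\<^sup>2)) / 2"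
    if "i \<in> {1..M}" "j \<in> {1..M}" for i j
    using \<sigma>[OF that(1)] \<sigma>[OF that(2)]
    unfolding P[OF that(1)] P[OF that(2)] p_def
    by (simp add: score_divergence_normal power2_commute[of "\<mu> i"])
  \<comment> \<open>Leaving the variance \<open>v\<close> free covers \<open>P_star\<close> and
    \<open>P_bar\<close>, which share their mean, by one computation.\<close>
  have divergence_gaussian: "score_divergence (gaussian mu_star v) (P i)
      = (((\<sigma> i)\<^sup>2 + (\<mu> i - mu_star)\<^sup>2) / v - 1 + ln v - ln ((\<sigma> i)\<^sup>2)) / 2"
    if "i \<in> {1..M}" "0 < v" for i v
    using \<sigma>[OF that(1)] that by (simp add: P p_def gaussian_def score_divergence_normal)
  have divergence_average: "(1 / real M) * (\<Sum>i=1..M. score_divergence (gaussian mu_star v) (P i))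
      = (1 / 2) * ((\<Sum>i=1..M. (\<sigma> i)\<^sup>2 + (\<mu> i - mu_star)\<^sup>2) / (v * real M) - 1 + ln v
          - (1 / real M) * (\<Sum>i=1..M. ln ((\<sigma> i)\<^sup>2)))" if v: "0 < v" for v
  proof -
    have "(\<Sum>i=1..M. score_divergence (gaussian mu_star v) (P i))
      = (\<Sum>i=1..M. (((\<sigma> i)\<^sup>2 + (\<mu> i - mu_star)\<^sup>2) / v - 1 + ln v - ln ((\<sigma> i)\<^sup>2)) / 2)"
      using v by (intro sum.cong) (auto simp: divergence_gaussian)
    also have "\<dots> = ((\<Sum>i=1..M. (\<sigma> i)\<^sup>2 + (\<mu> i - mu_star)\<^sup>2) / v - real M + real M * ln v
        - (\<Sum>i=1..M. ln ((\<sigma> i)\<^sup>2))) / 2"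
      by (simp only: sum_divide_distrib[symmetric] sum_subtractf sum.distrib[where h="\<lambda>_. ln v"]
          sum_constant) simp
    finally show ?thesis
      using M0 by (simp add: add_divide_distrib diff_divide_distrib)
  qed
  have divergence_P_sum: "(\<Sum>i=1..M. \<Sum>j=1..M. score_divergence (P i) (P j))
      = (\<Sum>i=1..M. \<Sum>j=1..M. ((\<sigma> j)\<^sup>2 + (\<mu> i - \<mu> j)\<^sup>2) / (\<sigma> i)\<^sup>2 - 1) / 2"
  proof -
    have "(\<Sum>i=1..M. \<Sum>j=1..M. score_divergence (P i) (P j))
      = (\<Sum>i=1..M. \<Sum>j=1..M. ((((\<sigma> j)\<^sup>2 + (\<mu> i - \<mu> j)\<^sup>2) / (\<sigma> i)\<^sup>2 - 1)
            + (ln ((\<sigma> i)\<^sup>2) - ln ((\<sigma> j)\<^sup>2))) / 2)"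
      by (intro sum.cong refl) (simp add: divergence_P)
    also have "\<dots> = ((\<Sum>i=1..M. \<Sum>j=1..M. ((\<sigma> j)\<^sup>2 + (\<mu> i - \<mu> j)\<^sup>2) / (\<sigma> i)\<^sup>2 - 1)
        + (\<Sum>i=1..M. \<Sum>j=1..M. ln ((\<sigma> i)\<^sup>2) - ln ((\<sigma> j)\<^sup>2))) / 2"
      by (simp only: sum_divide_distrib[symmetric] sum.distrib)
    \<comment> \<open>The summand is antisymmetric in \<open>i\<close> and \<open>j\<close>: either
      logarithm sums to \<open>M\<close> times the total of all logarithms.\<close>
    also have "(\<Sum>i=1..M. \<Sum>j=1..M. ln ((\<sigma> i)\<^sup>2) - ln ((\<sigma> j)\<^sup>2)) = 0"
      by (simp add: sum_subtractf sum_distrib_left)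
    finally show ?thesis by simp
  qed
  show ?thesis
  proof (intro conjI ballI)
    fix i j assume ij: "i \<in> {1..M}" "j \<in> {1..M}"
    show "integrable (P j) (log_score (P i))"
      using ij by (simp add: P integrable_log_score tame_p)
  next
    show "integrable P_ens (log_score P_ens)" "integrable P_star (log_score P_star)"
      "integrable P_ens (log_score P_star)"
      "integrable P_ens (entropy_density (exp 1) P_star P_ens)"
      unfolding P_ens P_star
      by (intro integrable_log_score integrable_entropy_density tame_r tame_q)+
  next
    fix i assume i: "i \<in> {1..M}"
    show "integrable (P i) (log_score P_ens)" "integrable P_ens (log_score (P i))"
      "integrable (P i) (log_score P_star)" "integrable (P i) (log_score P_bar)"
      "integrable (P i) (entropy_density (exp 1) P_ens (P i))"
      "integrable P_ens (entropy_density (exp 1) (P i) P_ens)"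
      unfolding P_ens P_star P_bar P[OF i]
      by (intro integrable_log_score integrable_entropy_density tame_r tame_q tame_b tame_p i)+
  next
    have "score_entropy (P i) = ln (2 * pi * exp 1 * (\<sigma> i)\<^sup>2) / 2" if "i \<in> {1..M}" for i
      using \<sigma>[OF that] by (simp add: P[OF that] p_def score_entropy_normal)
    then have "(\<Sum>i=1..M. score_entropy (P i)) = (\<Sum>i=1..M. ln (2 * pi * exp 1 * (\<sigma> i)\<^sup>2)) / 2"
      unfolding sum_divide_distrib by (intro sum.cong refl)
    then show "(1 / real M) * (\<Sum>i=1..M. score_entropy (P i))
        = (1 / (2 * real M)) * (\<Sum>i=1..M. ln (2 * pi * exp 1 * (\<sigma> i)\<^sup>2))"
      by (simp only:) simp
  next
    have "(\<Sum>i=1..M. score_entropy (P i)) \<le> (\<Sum>i=1..M. expected_score P_ens (P i))"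
      unfolding P_ens
      by (intro sum_mono) (simp add: P score_entropy_le_expected_score tame_r tame_p)
    \<comment> \<open>Linearity in the truth, applied with the mixture density \<open>r\<close>
      itself as prediction, yields the score of \<open>P_ens\<close> under
      \<open>P_ens\<close>.\<close>
    also have "\<dots> = real M * score_entropy P_ens"
      using M0 expected_score_average[OF M tame_r, of p, folded r_def] tame_p
      by (simp add: score_entropy_def P_ens P)
    finally show "(1 / real M) * (\<Sum>i=1..M. score_entropy (P i)) \<le> score_entropy P_ens"
      using M0 by (simp add: field_simps)
  next
    show "score_entropy P_star = (1 / 2) * ln (2 * pi * exp 1 * var_star)"
      using var_star_pos by (simp add: P_star q_def score_entropy_normal)
  next
    show "(1 / (real M)\<^sup>2) * (\<Sum>i=1..M. \<Sum>j=1..M. score_divergence (P i) (P j))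
        = (1 / (2 * (real M)\<^sup>2)) *
          (\<Sum>i=1..M. \<Sum>j=1..M. ((\<sigma> j)\<^sup>2 + (\<mu> i - \<mu> j)\<^sup>2) / (\<sigma> i)\<^sup>2 - 1)"
      unfolding divergence_P_sum by simp
  next
    have "score_divergence P_ens (P i) = D_KL (P i) P_ens"
      "score_divergence (P i) P_ens = D_KL P_ens (P i)" if "i \<in> {1..M}" for i
      unfolding P_ens P[OF that]
      by (intro score_divergence_eq_D_KL tame_r tame_p that)+
    then show "(1 / real M) * (\<Sum>i=1..M. score_divergence P_ens (P i))
        = (1 / real M) * (\<Sum>i=1..M. D_KL (P i) P_ens)"
      "(1 / real M) * (\<Sum>i=1..M. score_divergence (P i) P_ens)
        = (1 / real M) * (\<Sum>i=1..M. D_KL P_ens (P i))"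
      by simp_all
  next
    \<comment> \<open>For \<open>v = var_star\<close> the quadratic sum is
      \<open>real M * var_star\<close>, so its quotient is 1 and cancels the
      \<open>- 1\<close>.\<close>
    show "(1 / real M) * (\<Sum>i=1..M. score_divergence P_star (P i))
        = (1 / 2) * (ln var_star - (1 / real M) * (\<Sum>i=1..M. ln ((\<sigma> i)\<^sup>2)))"
      unfolding assms(8) divergence_average[OF var_star_pos] var_star_eq[symmetric]
      using M0 var_star_pos by simp
  next
    \<comment> \<open>For \<open>v = var_bar\<close> only the variances contribute the quotient 1;
      the deviations of the means survive as the extra term.\<close>
    show "(1 / real M) * (\<Sum>i=1..M. score_divergence P_bar (P i))
        = (1 / 2) * (ln var_bar - (1 / real M) * (\<Sum>i=1..M. ln ((\<sigma> i)\<^sup>2))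
            + (1 / (var_bar * real M)) * (\<Sum>i=1..M. (\<mu> i - mu_star)\<^sup>2))"
      unfolding assms(9) divergence_average[OF var_bar_pos] sum.distrib var_bar_eq[symmetric]
      using M0 var_bar_pos by (simp add: add_divide_distrib)
  next
    show "score_divergence P_star P_ens = D_KL P_ens P_star"
      unfolding P_ens P_star by (intro score_divergence_eq_D_KL tame_r tame_q)
  qed
qed

end
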